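(* Let $E$ be a group with a normal subgroup $G$, let $S$ be a supplement to $G$ in $E$, and let $\phi:S\to\mathrm{Aut}(G)$ be the action of $S$ on $G$ by conjugation. Then: 1. $\varphi: S\ltimes_\phi G\to E$, $(s,g)\mapsto sg$, is an epimorphism. 2. $E\cong (S\ltimes_\phi G)/\ker\varphi$, where $\ker\varphi=\{(u,u^{-1}) : u\in G\cap S\}\cong G\cap S$. 3. With $K=\ker\varphi$, one has $K\cap (S\times 1_G)=1=K\cap(1_S\times G)$ in $S\ltimes_\phi G$.
   Context: A supplement to $G$ in $E$ is a subgroup $S\le E$ with $E=SG$. Automorphisms act on the right, and $g^{\phi(s)}=s^{-1}gs$. For an action $\phi:S\to\mathrm{Aut}(G)$, the semi-direct product $S\ltimes_\phi G$ is the set of pairs $(s,g)$, $s\in S$, $g\in G$, with multiplication $(s_1,g_1)(s_2,g_2)=(s_1s_2,\,g_1^{\phi(s_2)}g_2)$. $S\times 1_G=\{(s,1)\}$ and $1_S\times G=\{(1,g)\}$ are the canonical copies of $S$ and $G$. *)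

theory Defs
  imports "HOL-Algebra.Coset" "HOL-Algebra.Bij"
begin

definition supplement :: "'a set \<Rightarrow> 'a set \<Rightarrow> ('a, 'b) monoid_scheme \<Rightarrow> bool"
  where "supplement S G E \<longleftrightarrow> subgroup S E \<and> carrier E = S <#>\<^bsub>E\<^esub> G"

text \<open>
  Automorphisms act on the right, so the product of \<open>f\<close> and \<open>g\<close> is ``first \<open>f\<close>, then \<open>g\<close>'';
  multiplication in \<^const>\<open>AutoGroup\<close> composes in the opposite order. An action of \<open>S\<close> on \<open>G\<close>
  is an element of \<open>hom S (right_aut_group G)\<close>.
\<close>

definition right_aut_group :: "('a, 'b) monoid_scheme \<Rightarrow> ('a \<Rightarrow> 'a) monoid"
  where "right_aut_group G = (AutoGroup G)\<lparr>mult := \<lambda>f g. g \<otimes>\<^bsub>AutoGroup G\<^esub> f\<rparr>"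

text \<open>The restriction to \<open>G\<close> is needed because \<^const>\<open>AutoGroup\<close> has extensional functions only.\<close>

definition conj_action :: "('a, 'b) monoid_scheme \<Rightarrow> 'a set \<Rightarrow> 'a \<Rightarrow> 'a \<Rightarrow> 'a"
  where "conj_action E G s = (\<lambda>g\<in>G. inv\<^bsub>E\<^esub> s \<otimes>\<^bsub>E\<^esub> g \<otimes>\<^bsub>E\<^esub> s)"

definition semidirect_product ::
    "('s, 'b) monoid_scheme \<Rightarrow> ('s \<Rightarrow> 'g \<Rightarrow> 'g) \<Rightarrow> ('g, 'c) monoid_scheme \<Rightarrow> ('s \<times> 'g) monoid"
  where "semidirect_product S \<phi> G =
    \<lparr>carrier = carrier S \<times> carrier G,
     mult = (\<lambda>(s\<^sub>1, g\<^sub>1) (s\<^sub>2, g\<^sub>2). (s\<^sub>1 \<otimes>\<^bsub>S\<^esub> s\<^sub>2, \<phi> s\<^sub>2 g\<^sub>1 \<otimes>\<^bsub>G\<^esub> g\<^sub>2)),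
     one = (\<one>\<^bsub>S\<^esub>, \<one>\<^bsub>G\<^esub>)\<rparr>"

end

theory Submission
  imports Defs
begin

text \<open>Everything rests on the identity s g t h = (s t)(t^-1 g t) h. The twist in the
  semidirect multiplication is exactly the cost of moving t to the left past g, so multiplying the
  two coordinates in E is a homomorphism, and E = SG says that it is onto. A pair (s, g) is sent to
  1 iff g = s^-1, which puts s in both S and G. Each coordinate of a kernel element therefore
  determines the other: the first one identifies the kernel with G \<inter> S, and if either is
  trivial, so is the pair. The quotient statement is the first isomorphism theorem. Two lemmas
  prepare this: \<open>group_semidirect_product\<close> builds the group from an arbitrary right
  action, and \<open>conj_action_hom\<close> shows that conjugation is such an action, by
  normality.\<close>

lemma carrier_right_aut_group: "carrier (right_aut_group G) = auto G"
  by (simp add: right_aut_group_def AutoGroup_def)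

lemma mult_right_aut_group:
  "f \<in> auto G \<Longrightarrow> g \<in> auto G \<Longrightarrow> f \<otimes>\<^bsub>right_aut_group G\<^esub> g = compose (carrier G) g f"
  by (simp add: right_aut_group_def AutoGroup_def BijGroup_def auto_def)

lemma one_right_aut_group: "\<one>\<^bsub>right_aut_group G\<^esub> = (\<lambda>x\<in>carrier G. x)"
  by (simp add: right_aut_group_def AutoGroup_def BijGroup_def)

text \<open>This is the opposite group of \<open>AutoGroup G\<close>, so the left inverse that
  \<open>groupI\<close> asks for is a right inverse there.\<close>

lemma (in group) group_right_aut_group: "group (right_aut_group G)"
proof -
  interpret A: group "AutoGroup G"
    by (rule AutoGroup)
  show ?thesis
    by (rule groupI) (auto simp: right_aut_group_def A.m_assoc intro: A.r_inv A.inv_closed)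
qed

text \<open>Once \<open>m_assoc\<close> has nested a word to the right, these rules cancel a letter
  against a neighbouring inverse inside it.\<close>

lemma (in group) inv_cancel_left:
  "x \<in> carrier G \<Longrightarrow> y \<in> carrier G \<Longrightarrow> x \<otimes> (inv x \<otimes> y) = y"
  "x \<in> carrier G \<Longrightarrow> y \<in> carrier G \<Longrightarrow> inv x \<otimes> (x \<otimes> y) = y"
  by (simp_all flip: m_assoc)

lemma group_semidirect_product:
  assumes "group S" "group G" and \<phi>: "\<phi> \<in> hom S (right_aut_group G)"
  shows "group (semidirect_product S \<phi> G)"
proof -
  interpret S: group S by fact
  interpret G: group G by fact
  have aut: "\<phi> s \<in> auto G" if "s \<in> carrier S" for s
    using \<phi> that by (auto simp: hom_def carrier_right_aut_group)
  have closed [simp]: "\<phi> s x \<in> carrier G" if "s \<in> carrier S" "x \<in> carrier G" for s x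
    using aut[OF that(1)] that(2) by (auto simp: auto_def hom_def)
  have mult: "\<phi> s (x \<otimes>\<^bsub>G\<^esub> y) = \<phi> s x \<otimes>\<^bsub>G\<^esub> \<phi> s y"
    if "s \<in> carrier S" "x \<in> carrier G" "y \<in> carrier G" for s x y
    using aut[OF that(1)] that(2,3) by (auto simp: auto_def hom_def)
  \<comment> \<open>The order is that of a right action: s acts before t. Associativity of the
    product depends on it.\<close>
  have comp: "\<phi> (s \<otimes>\<^bsub>S\<^esub> t) x = \<phi> t (\<phi> s x)"
    if "s \<in> carrier S" "t \<in> carrier S" "x \<in> carrier G" for s t x
    using that hom_mult[OF \<phi>] by (simp add: aut mult_right_aut_group compose_def)
  have one: "\<phi> \<one>\<^bsub>S\<^esub> x = x" if "x \<in> carrier G" for x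
    using that hom_one[OF \<phi> \<open>group S\<close> G.group_right_aut_group] by (simp add: one_right_aut_group)
  have map_one: "\<phi> s \<one>\<^bsub>G\<^esub> = \<one>\<^bsub>G\<^esub>" if "s \<in> carrier S" for s
    using aut[OF that] by (auto simp: auto_def intro: hom_one \<open>group G\<close>)
  show ?thesis
  proof (rule groupI)
    fix x assume "x \<in> carrier (semidirect_product S \<phi> G)"
    then obtain s g where x: "x = (s, g)" "s \<in> carrier S" "g \<in> carrier G"
      by (auto simp: semidirect_product_def)
    \<comment> \<open>The left inverse of (s, g) needs second coordinate y with
      \<open>\<phi> s y\<close> equal to the inverse of g. Applying the action of s^-1 to g^-1
      yields it, since s^-1 followed by s acts trivially.\<close>
    have "\<phi> s (\<phi> (inv\<^bsub>S\<^esub> s) (inv\<^bsub>G\<^esub> g)) = inv\<^bsub>G\<^esub> g"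
      using x by (simp add: one flip: comp)
    with x show "\<exists>y\<in>carrier (semidirect_product S \<phi> G).
        y \<otimes>\<^bsub>semidirect_product S \<phi> G\<^esub> x = \<one>\<^bsub>semidirect_product S \<phi> G\<^esub>"
      by (intro bexI[of _ "(inv\<^bsub>S\<^esub> s, \<phi> (inv\<^bsub>S\<^esub> s) (inv\<^bsub>G\<^esub> g))"])
         (auto simp: semidirect_product_def)
  qed (auto simp: semidirect_product_def S.m_assoc G.m_assoc mult comp map_one)
qed

text \<open>Normality keeps conjugation inside \<open>H\<close>, and conjugation by s^-1 undoes it.
  The order of composition matches because (s t)^-1 x (s t) = t^-1 (s^-1 x s) t.\<close>

lemma (in normal) conj_action_hom:
  assumes "subgroup S G"
  shows "conj_action G H \<in> hom (G\<lparr>carrier := S\<rparr>) (right_aut_group (G\<lparr>carrier := H\<rparr>))"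
proof (rule homI)
  show conj_auto: "conj_action G H s \<in> carrier (right_aut_group (G\<lparr>carrier := H\<rparr>))"
    if "s \<in> carrier (G\<lparr>carrier := S\<rparr>)" for s
  proof -
    have s [simp]: "s \<in> carrier G"
      using that subgroup.mem_carrier[OF assms] by simp
    have "bij_betw (conj_action G H s) H H"
    proof (rule bij_betw_byWitness[where f' = "\<lambda>x. s \<otimes> x \<otimes> inv s"])
      show "\<forall>x\<in>H. s \<otimes> conj_action G H s x \<otimes> inv s = x"
        by (simp add: conj_action_def m_assoc inv_cancel_left)
      \<comment> \<open>The restriction to \<open>H\<close> has to be resolved while s x s^-1 still
        has the shape matched by \<open>inv_op_closed2\<close>; only then is the word
        reassociated.\<close>
      show "\<forall>x\<in>H. conj_action G H s (s \<otimes> x \<otimes> inv s) = x"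
        by (simp add: conj_action_def inv_op_closed2) (simp add: m_assoc inv_cancel_left)
    qed (auto simp: conj_action_def inv_op_closed1 inv_op_closed2)
    moreover have "conj_action G H s \<in> hom (G\<lparr>carrier := H\<rparr>) (G\<lparr>carrier := H\<rparr>)"
      by (rule homI) (simp_all add: conj_action_def inv_op_closed1, simp add: m_assoc inv_cancel_left)
    moreover have "conj_action G H s \<in> extensional H"
      by (simp add: conj_action_def)
    ultimately show ?thesis
      by (simp add: carrier_right_aut_group auto_def Bij_def)
  qed
  fix s t assume "s \<in> carrier (G\<lparr>carrier := S\<rparr>)" "t \<in> carrier (G\<lparr>carrier := S\<rparr>)"
  moreover from this have "s \<in> carrier G" "t \<in> carrier G"
    using subgroup.mem_carrier[OF assms] by simp_all
  ultimately show "conj_action G H (s \<otimes>\<^bsub>G\<lparr>carrier := S\<rparr>\<^esub> t) =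
      conj_action G H s \<otimes>\<^bsub>right_aut_group (G\<lparr>carrier := H\<rparr>)\<^esub> conj_action G H t"
    using conj_auto inv_op_closed1
    by (simp add: carrier_right_aut_group mult_right_aut_group)
       (auto simp: conj_action_def compose_def inv_mult_group m_assoc intro!: restrict_ext)
qed

theorem theorem3p1p1:
  fixes E :: "('a, 'b) monoid_scheme" and G S :: "'a set"
  assumes "group E" and "G \<lhd> E" and "supplement S G E"
  defines "\<phi> \<equiv> conj_action E G"
  defines "P \<equiv> semidirect_product (E\<lparr>carrier := S\<rparr>) \<phi> (E\<lparr>carrier := G\<rparr>)"
  defines "\<psi> \<equiv> \<lambda>(s, g). s \<otimes>\<^bsub>E\<^esub> g"
  defines "K \<equiv> kernel P E \<psi>"
  shows "\<phi> \<in> hom (E\<lparr>carrier := S\<rparr>) (right_aut_group (E\<lparr>carrier := G\<rparr>))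
    \<and> group P
    \<and> \<psi> \<in> epi P E
    \<and> E \<cong> P Mod K
    \<and> K = {(u, inv\<^bsub>E\<^esub> u) | u. u \<in> G \<inter> S}
    \<and> P\<lparr>carrier := K\<rparr> \<cong> E\<lparr>carrier := G \<inter> S\<rparr>
    \<and> K \<inter> (S \<times> {\<one>\<^bsub>E\<^esub>}) = {\<one>\<^bsub>P\<^esub>}
    \<and> K \<inter> ({\<one>\<^bsub>E\<^esub>} \<times> G) = {\<one>\<^bsub>P\<^esub>}"
proof -
  interpret group E by fact
  interpret G: normal G E by fact
  have S: "subgroup S E" and ES: "carrier E = S <#>\<^bsub>E\<^esub> G"
    using assms(3) by (auto simp: supplement_def)
  have GE: "group (E\<lparr>carrier := G\<rparr>)" and SE: "group (E\<lparr>carrier := S\<rparr>)"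
    using S G.subgroup_axioms subgroup.subgroup_is_group group_axioms by blast+
  note carr [simp] = subgroup.mem_carrier[OF S] G.mem_carrier
  have \<phi>: "\<phi> \<in> hom (E\<lparr>carrier := S\<rparr>) (right_aut_group (E\<lparr>carrier := G\<rparr>))"
    unfolding \<phi>_def using S by (rule G.conj_action_hom)
  have P: "group P"
    unfolding P_def using SE GE \<phi> by (rule group_semidirect_product)
  have P_simps: "carrier P = S \<times> G" "\<one>\<^bsub>P\<^esub> = (\<one>\<^bsub>E\<^esub>, \<one>\<^bsub>E\<^esub>)"
      "(s, g) \<otimes>\<^bsub>P\<^esub> (t, h) = (s \<otimes>\<^bsub>E\<^esub> t, \<phi> t g \<otimes>\<^bsub>E\<^esub> h)" for s g t h
    by (simp_all add: P_def semidirect_product_def)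
  have hom: "\<psi> \<in> hom P E"
  proof (rule homI)
    fix x y assume "x \<in> carrier P" "y \<in> carrier P"
    then show "\<psi> (x \<otimes>\<^bsub>P\<^esub> y) = \<psi> x \<otimes>\<^bsub>E\<^esub> \<psi> y"
      by (cases x, cases y)
         (simp add: P_simps \<psi>_def \<phi>_def conj_action_def m_assoc inv_cancel_left)
  qed (auto simp: P_simps \<psi>_def)
  \<comment> \<open>Surjectivity is the supplement condition itself.\<close>
  have epi: "\<psi> \<in> epi P E"
    using hom ES by (fastforce simp: epi_iff_subset P_simps \<psi>_def set_mult_def)
  have K: "K = {(u, inv\<^bsub>E\<^esub> u) | u. u \<in> G \<inter> S}"
  proof (intro equalityI subsetI)
    fix x assume "x \<in> K"
    then obtain s g where x: "x = (s, g)" "s \<in> S" "g \<in> G" "s \<otimes>\<^bsub>E\<^esub> g = \<one>\<^bsub>E\<^esub>"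
      by (auto simp: K_def kernel_def P_simps \<psi>_def)
    \<comment> \<open>Being the inverse of an element of \<open>G\<close>, s lies in
      \<open>G\<close> as well as in \<open>S\<close>, and g is its inverse.\<close>
    then have "s = inv\<^bsub>E\<^esub> g"
      by (metis inv_equality carr)
    with x show "x \<in> {(u, inv\<^bsub>E\<^esub> u) | u. u \<in> G \<inter> S}"
      by auto
  qed (auto simp: K_def kernel_def P_simps \<psi>_def)
  interpret \<psi>: group_hom P E \<psi>
    using P hom by (simp add: group_hom_def group_hom_axioms_def group_axioms)
  have "P Mod K \<cong> E"
    unfolding K_def using epi by (intro \<psi>.FactGroup_iso) (simp add: epi_def)
  then have quotient: "E \<cong> P Mod K"
    unfolding K_def by (rule group.iso_sym[OF normal.factorgroup_is_group[OF \<psi>.normal_kernel]])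
  \<comment> \<open>The first coordinate is multiplied without any twist, and on \<open>K\<close> it
    determines the second.\<close>
  have "fst \<in> iso (P\<lparr>carrier := K\<rparr>) (E\<lparr>carrier := G \<inter> S\<rparr>)"
    by (rule isoI)
       (auto simp: hom_def K P_simps bij_betw_def inj_on_def image_def)
  then have "P\<lparr>carrier := K\<rparr> \<cong> E\<lparr>carrier := G \<inter> S\<rparr>"
    by (rule is_isoI)
  \<comment> \<open>In a pair (u, u^-1), one entry is trivial iff the other is.\<close>
  moreover have "K \<inter> (S \<times> {\<one>\<^bsub>E\<^esub>}) = {\<one>\<^bsub>P\<^esub>}" "K \<inter> ({\<one>\<^bsub>E\<^esub>} \<times> G) = {\<one>\<^bsub>P\<^esub>}"
    using subgroup.one_closed[OF S] by (auto simp: K P_simps) (metis carr(1) inv_eq_1_iff)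
  ultimately show ?thesis
    using \<phi> P epi quotient K by blast
qed

end
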